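(* Let $K=\mathbb{F}_q$ be a finite field, let $v_1,\ldots,v_n$ be positive integers, let $X\subset\mathbb{P}^{n-1}$ be the degenerate projective torus parameterized by $x_1^{v_1},\ldots,x_n^{v_n}$, with vanishing ideal $I(X)\subset S=K[t_1,\ldots,t_n]$, and let $X^*=\{(x_1^{v_1},\ldots,x_n^{v_n}) : x_i\in K^*\text{ for all }i\}\subset K^n$. Let $\beta$ be a generator of the cyclic group $K^*$ and let $d_i$ be the order of $\beta^{v_i}$ in $K^*$. Then $|X^*|=d_1\cdots d_n$ and $$\deg(S/I(X))=|X|=d_1\cdots d_n/\gcd(d_1,\ldots,d_n).$$
   Context: $X=\{[(x_1^{v_1},\ldots,x_n^{v_n})] : x_i\in K^*\text{ for all }i\}\subset\mathbb{P}^{n-1}$, where $\mathbb{P}^{n-1}$ is the projective space over $K$ and $K^*=K\setminus\{0\}$. $S=K[t_1,\ldots,t_n]=\oplus_{d\ge 0}S_d$ has the standard grading, and $I(X)$ is the ideal of $S$ generated by the homogeneous polynomials that vanish at all points of $X$. The Hilbert function of $S/I(X)$ is $H_X(d)=\dim_K(S_d/(I(X)\cap S_d))$. The Hilbert polynomial $h_X(t)=\sum_{i=0}^{k-1}c_it^i\in\mathbb{Q}[t]$, of degree $k-1=\dim(S/I(X))-1$, is the unique polynomial with $h_X(d)=H_X(d)$ for $d\gg 0$. The degree is $\deg(S/I(X))=c_{k-1}(k-1)!$. (Here $\dim(S/I(X))=1$, so $h_X$ is the constant $c_0=\deg(S/I(X))$.) *)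

theory Defs
  imports
    "HOL-Library.Poly_Mapping"
    "HOL-Computational_Algebra.Primes"
    "HOL-Computational_Algebra.Polynomial"
    "HOL-Algebra.QuotRing"
    "HOL-Algebra.Multiplicative_Group"
    "HOL-Algebra.Generated_Groups"
    "Jordan_Normal_Form.VS_Connect"
begin

text \<open>
  The variables \<open>t\<^sub>i\<close> are indexed by a finite type \<open>'n\<close> in place of \<open>{1..n}\<close>.  A monomial is its
  exponent vector in \<open>'n \<Rightarrow>\<^sub>0 nat\<close>, and a polynomial is a finitely supported map from monomials to
  coefficients; the ring structure on the latter is the convolution product of
  \<^theory>\<open>HOL-Library.Poly_Mapping\<close>.  Points of \<open>K\<^sup>n\<close> are functions \<open>'n \<Rightarrow> 'k\<close>.
\<close>

type_synonym ('n, 'k) mpoly = "('n \<Rightarrow>\<^sub>0 nat) \<Rightarrow>\<^sub>0 'k"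

definition mpoly_eval :: "('n::finite \<Rightarrow> 'k) \<Rightarrow> ('n, 'k::comm_ring_1) mpoly \<Rightarrow> 'k" where
  "mpoly_eval x f =
     (\<Sum>m \<in> Poly_Mapping.keys f.
        Poly_Mapping.lookup f m * (\<Prod>i\<in>UNIV. x i ^ Poly_Mapping.lookup m i))"

definition homogeneous :: "nat \<Rightarrow> ('n::finite, 'k::zero) mpoly \<Rightarrow> bool" where
  "homogeneous d f \<longleftrightarrow>
     (\<forall>m \<in> Poly_Mapping.keys f. (\<Sum>i\<in>UNIV. Poly_Mapping.lookup m i) = d)"

text \<open>The component \<open>S\<^sub>d\<close> as a \<open>K\<close>-vector space; it contains 0, which is homogeneous of every degree.
  The multiplicative fields of the record play no role for modules.\<close>

definition graded_component :: "nat \<Rightarrow> ('k::field, ('n::finite, 'k) mpoly) module" where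
  "graded_component d =
     \<lparr> carrier = {f. homogeneous d f}, mult = undefined, one = undefined,
       zero = 0, add = (+),
       smult = (\<lambda>c f. Poly_Mapping.single 0 c * f) \<rparr>"

definition quotient_module ::
  "('a, 'b, 'c) module_scheme \<Rightarrow> 'b set \<Rightarrow> ('a, 'b set) module" where
  "quotient_module V W =
     \<lparr> carrier = a_rcosets\<^bsub>V\<^esub> W, mult = undefined, one = undefined,
       zero = W, add = (\<lambda>A B. A <+>\<^bsub>V\<^esub> B),
       smult = (\<lambda>c A. \<Union>a\<in>A. W +>\<^bsub>V\<^esub> (c \<odot>\<^bsub>V\<^esub> a)) \<rparr>"

definition hilbert_function :: "('n::finite, 'k::field) mpoly set \<Rightarrow> nat \<Rightarrow> nat" where
  "hilbert_function I d =
     vectorspace.dim (class_ring :: 'k ring)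
       (quotient_module (graded_component d)
          (I \<inter> carrier (graded_component d :: ('k, ('n, 'k) mpoly) module)))"

definition hilbert_polynomial :: "('n::finite, 'k::field) mpoly set \<Rightarrow> rat poly" where
  "hilbert_polynomial I =
     (THE h. \<forall>\<^sub>F d in sequentially. poly h (of_nat d) = of_nat (hilbert_function I d))"

text \<open>The degree of \<open>S/I\<close>: for \<open>k - 1\<close> the degree of the Hilbert polynomial, its coefficient at
  \<open>k - 1\<close> times \<open>(k - 1)!\<close>.\<close>

definition quotient_degree :: "('n::finite, 'k::field) mpoly set \<Rightarrow> rat" where
  "quotient_degree I =
     (let h = hilbert_polynomial I
      in Polynomial.coeff h (Polynomial.degree h) * fact (Polynomial.degree h))"

text \<open>Projective points are equivalence classes of nonzero vectors, so \<open>[x]\<close> is \<open>proj_rel `` {x}\<close>.\<close>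

definition proj_rel :: "(('n \<Rightarrow> 'k::field) \<times> ('n \<Rightarrow> 'k)) set" where
  "proj_rel = {(x, y). x \<noteq> (\<lambda>_. 0) \<and> y \<noteq> (\<lambda>_. 0) \<and> (\<exists>c. c \<noteq> 0 \<and> y = (\<lambda>i. c * x i))}"

definition proj_space :: "('n \<Rightarrow> 'k::field) set set" where
  "proj_space = (UNIV - {\<lambda>_. 0}) // proj_rel"

definition affine_torus :: "('n \<Rightarrow> nat) \<Rightarrow> ('n \<Rightarrow> 'k::field) set" where
  "affine_torus v = {(\<lambda>i. x i ^ v i) | x. \<forall>i. x i \<noteq> 0}"

definition proj_torus :: "('n \<Rightarrow> nat) \<Rightarrow> ('n \<Rightarrow> 'k::field) set set" where
  "proj_torus v = {proj_rel `` {\<lambda>i. x i ^ v i} | x. \<forall>i. x i \<noteq> 0}"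

lemma proj_torus_subset: "proj_torus v \<subseteq> proj_space"
  by (auto simp: proj_torus_def proj_space_def fun_eq_iff intro!: quotientI)

abbreviation unit_group_of_field :: "'k::field monoid" where
  "unit_group_of_field \<equiv> mult_of class_ring"

text \<open>A homogeneous polynomial vanishes at a projective point iff it vanishes at one, equivalently
  every, representative.\<close>

definition vanishing_ideal ::
  "('n::finite \<Rightarrow> 'k::field) set set \<Rightarrow> ('n, 'k) mpoly set" where
  "vanishing_ideal X =
     Idl\<^bsub>class_ring\<^esub> {f. (\<exists>d. homogeneous d f) \<and> (\<forall>P\<in>X. \<forall>y\<in>P. mpoly_eval y f = 0)}"

end

theory Submission
  imports Defs
begin

text \<open>
  For any finite set \<open>X\<close> of projective points, \<open>I(X) \<inter> S\<^sub>d\<close> is the kernel of the evaluation map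
  from \<open>S\<^sub>d\<close> to \<open>K\<close>-valued functions on a set of representatives.  Once \<open>d \<ge> |X| - 1\<close> this map is
  surjective: a product of \<open>|X| - 1\<close> linear forms, each separating the given point from one other
  point, times a power of a variable vanishes at all points but one.  Hence the Hilbert function is
  eventually the constant \<open>|X|\<close>, and so is the degree.

  The \<open>v\<^sub>i\<close>-th powers of units are exactly the \<open>d\<^sub>i\<close>-th roots of unity: they are contained in
  these, there are \<open>d\<^sub>i\<close> of them, and \<open>t\<^bsup>d\<^esup> - 1\<close> has at most \<open>d\<close> roots.  So \<open>X\<^sup>*\<close> is a product of groups
  of roots of unity, and the fibres of \<open>X\<^sup>* \<rightarrow> X\<close> are the orbits of the scalars \<open>c\<close> with
  \<open>c\<^bsup>d\<^sub>i\<^esup> = 1\<close> for all \<open>i\<close>, that is, of the \<open>gcd(d\<^sub>1, \<dots>, d\<^sub>n)\<close>-th roots of unity.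
\<close>

section \<open>Quotients of vector spaces by kernels\<close>

text \<open>Transport of structure along a surjection: each axiom for \<open>M\<close> is the
  \<open>F\<close>-image of the same axiom in \<open>N\<close>. This turns a raw record, such as a
  quotient, into a vector space.\<close>

lemma vectorspace_hom_image:
  assumes N: "vectorspace K N"
    and carr: "carrier M = F ` carrier N"
    and zero: "\<zero>\<^bsub>M\<^esub> = F \<zero>\<^bsub>N\<^esub>"
    and add: "\<And>a b. a \<in> carrier N \<Longrightarrow> b \<in> carrier N \<Longrightarrow> F a \<oplus>\<^bsub>M\<^esub> F b = F (a \<oplus>\<^bsub>N\<^esub> b)"
    and smult: "\<And>c a. c \<in> carrier K \<Longrightarrow> a \<in> carrier N \<Longrightarrow> c \<odot>\<^bsub>M\<^esub> F a = F (c \<odot>\<^bsub>N\<^esub> a)"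
  shows "vectorspace K M" and "linear_map K N M F"
proof -
  interpret N: vectorspace K N by fact
  show M: "vectorspace K M"
  proof (rule vs_criteria)
    show "field K" by (rule N.field_axioms)
    show "\<forall>v\<in>carrier M. \<exists>neg_v\<in>carrier M. v \<oplus>\<^bsub>M\<^esub> neg_v = \<zero>\<^bsub>M\<^esub>"
    proof
      fix v assume "v \<in> carrier M"
      then obtain a where a: "a \<in> carrier N" "v = F a" using carr by auto
      then have "v \<oplus>\<^bsub>M\<^esub> F (\<ominus>\<^bsub>N\<^esub> a) = \<zero>\<^bsub>M\<^esub>" by (simp add: add zero N.r_neg)
      moreover have "F (\<ominus>\<^bsub>N\<^esub> a) \<in> carrier M" using a carr by simp
      ultimately show "\<exists>neg_v\<in>carrier M. v \<oplus>\<^bsub>M\<^esub> neg_v = \<zero>\<^bsub>M\<^esub>" by blast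
    qed
  qed (auto simp: carr zero add smult N.a_ac N.smult_assoc1 N.smult_l_distr N.smult_r_distr)
  interpret M: vectorspace K M by fact
  show "linear_map K N M F"
    by unfold_locales (auto simp: module_hom_def carr add smult)
qed

text \<open>First isomorphism theorem read backwards: sending \<open>w\<close> to its fibre under
  \<open>T\<close> is a linear bijection from \<open>N\<close> onto the cosets of the kernel, so the
  structure of \<open>N\<close> is carried over to the quotient.\<close>

lemma quotient_module_kernel:
  assumes T: "linear_map K V N T" and surj: "T ` carrier V = carrier N"
    and fin: "vectorspace.fin_dim K N"
  shows "vectorspace.dim K (quotient_module V {f \<in> carrier V. T f = \<zero>\<^bsub>N\<^esub>}) = vectorspace.dim K N"
proof -
  interpret V: vectorspace K V using T by (simp add: linear_map_def)
  interpret N: vectorspace K N using T by (simp add: linear_map_def)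
  have T_closed: "T f \<in> carrier N" if "f \<in> carrier V" for f
    using that surj by blast
  note T_simps = T_closed linear_map.T_add[OF T] linear_map.T_smult[OF T] linear_map.T_neg[OF T]
  define W where "W = {f \<in> carrier V. T f = \<zero>\<^bsub>N\<^esub>}"
  define Q where "Q = quotient_module V W"
  define F where "F w = {g \<in> carrier V. T g = w}" for w
  have fiber: "\<exists>g. g \<in> carrier V \<and> T g = w" if "w \<in> carrier N" for w
    using that surj by (metis imageE)
  have coset: "W +>\<^bsub>V\<^esub> f = F (T f)" if f: "f \<in> carrier V" for f
  proof
    show "W +>\<^bsub>V\<^esub> f \<subseteq> F (T f)"
      using f by (auto simp: a_r_coset_def' W_def F_def T_simps)
    show "F (T f) \<subseteq> W +>\<^bsub>V\<^esub> f"
    proof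
      fix g assume "g \<in> F (T f)"
      then have g: "g \<in> carrier V" "T g = T f" by (auto simp: F_def)
      have "g \<ominus>\<^bsub>V\<^esub> f \<in> W" using f g by (simp add: W_def T_simps N.r_neg a_minus_def)
      moreover have "g = (g \<ominus>\<^bsub>V\<^esub> f) \<oplus>\<^bsub>V\<^esub> f"
        using f g by (simp add: a_minus_def V.a_assoc V.l_neg)
      ultimately show "g \<in> W +>\<^bsub>V\<^esub> f" unfolding a_r_coset_def' by blast
    qed
  qed
  have carr: "carrier Q = F ` carrier N"
    unfolding Q_def quotient_module_def surj[symmetric]
    by (auto simp: A_RCOSETS_def' coset image_iff)
  have add: "F a \<oplus>\<^bsub>Q\<^esub> F b = F (a \<oplus>\<^bsub>N\<^esub> b)" if ab: "a \<in> carrier N" "b \<in> carrier N" for a b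
  proof -
    obtain f where f: "f \<in> carrier V" "T f = a" using fiber ab by blast
    have "F a <+>\<^bsub>V\<^esub> F b = F (a \<oplus>\<^bsub>N\<^esub> b)"
    proof
      show "F a <+>\<^bsub>V\<^esub> F b \<subseteq> F (a \<oplus>\<^bsub>N\<^esub> b)" by (auto simp: set_add_def' F_def T_simps)
      show "F (a \<oplus>\<^bsub>N\<^esub> b) \<subseteq> F a <+>\<^bsub>V\<^esub> F b"
      proof
        fix g assume "g \<in> F (a \<oplus>\<^bsub>N\<^esub> b)"
        then have g: "g \<in> carrier V" "T g = a \<oplus>\<^bsub>N\<^esub> b" by (auto simp: F_def)
        \<comment> \<open>With \<open>f\<close> a fixed point of the fibre over \<open>a\<close>,
          the remainder of \<open>g\<close> must lie over \<open>b\<close>.\<close>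
        have "\<ominus>\<^bsub>V\<^esub> f \<oplus>\<^bsub>V\<^esub> g \<in> F b"
          using f g ab by (auto simp: F_def T_simps N.r_neg1)
        moreover have "g = f \<oplus>\<^bsub>V\<^esub> (\<ominus>\<^bsub>V\<^esub> f \<oplus>\<^bsub>V\<^esub> g)" using f g by (simp add: V.r_neg2)
        moreover have "f \<in> F a" using f by (simp add: F_def)
        ultimately show "g \<in> F a <+>\<^bsub>V\<^esub> F b" unfolding set_add_def' by blast
      qed
    qed
    then show ?thesis by (simp add: Q_def quotient_module_def)
  qed
  have smult: "c \<odot>\<^bsub>Q\<^esub> F a = F (c \<odot>\<^bsub>N\<^esub> a)" if ca: "c \<in> carrier K" "a \<in> carrier N" for c a
  proof -
    \<comment> \<open>Scaling a coset is a union over its representatives. All terms are the same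
      fibre, and surjectivity of \<open>T\<close> makes the index set nonempty, so the union
      collapses.\<close>
    have "(\<Union>g\<in>F a. W +>\<^bsub>V\<^esub> (c \<odot>\<^bsub>V\<^esub> g)) = (\<Union>g\<in>F a. F (c \<odot>\<^bsub>N\<^esub> a))"
      by (rule SUP_cong) (use ca in \<open>auto simp: F_def coset T_simps\<close>)
    also have "\<dots> = F (c \<odot>\<^bsub>N\<^esub> a)" using fiber[OF ca(2)] by (auto simp: F_def)
    finally show ?thesis by (simp add: Q_def quotient_module_def)
  qed
  have zero: "\<zero>\<^bsub>Q\<^esub> = F \<zero>\<^bsub>N\<^esub>" by (simp add: Q_def quotient_module_def W_def F_def)
  interpret FQ: linear_map K N Q F
    by (rule vectorspace_hom_image(2)[OF N.vectorspace_axioms carr zero add smult])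
  have "inj_on F (carrier N)"
    unfolding inj_on_def F_def using fiber by blast
  then have "vectorspace.dim K N = vectorspace.dim K Q"
    by (intro FQ.dim_eq fin) (simp_all add: carr)
  then show ?thesis by (simp add: Q_def W_def)
qed

section \<open>Evaluation of homogeneous polynomials\<close>

text \<open>Supports can shrink under addition; padding with monomials of coefficient 0 puts sums
  over different supports on a common index set.\<close>

lemma mpoly_eval_superset:
  assumes "finite A" "Poly_Mapping.keys f \<subseteq> A"
  shows "mpoly_eval x f =
    (\<Sum>m\<in>A. Poly_Mapping.lookup f m * (\<Prod>i\<in>UNIV. x i ^ Poly_Mapping.lookup m i))"
  unfolding mpoly_eval_def
  by (rule sum.mono_neutral_left) (use assms in \<open>auto simp: in_keys_iff\<close>)

lemma mpoly_eval_0 [simp]: "mpoly_eval x 0 = 0"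
  by (simp add: mpoly_eval_def)

lemma mpoly_eval_single [simp]:
  "mpoly_eval x (Poly_Mapping.single m c) = c * (\<Prod>i\<in>UNIV. x i ^ Poly_Mapping.lookup m i)"
  by (simp add: mpoly_eval_superset[of "{m}"])

lemma mpoly_eval_add [simp]: "mpoly_eval x (f + g) = mpoly_eval x f + mpoly_eval x g"
  using keys_add[of f g]
  by (simp add: mpoly_eval_superset[of "Poly_Mapping.keys f \<union> Poly_Mapping.keys g"]
      lookup_add distrib_right sum.distrib)

lemma mpoly_eval_uminus [simp]: "mpoly_eval x (- f) = - mpoly_eval x f"
  by (simp add: mpoly_eval_def sum_negf)

lemma mpoly_eval_diff [simp]: "mpoly_eval x (f - g) = mpoly_eval x f - mpoly_eval x g"
  using mpoly_eval_add[of x f "- g"] by simp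

lemma mpoly_eval_sum [simp]: "mpoly_eval x (\<Sum>i\<in>A. f i) = (\<Sum>i\<in>A. mpoly_eval x (f i))"
  by (induction A rule: infinite_finite_induct) auto

lemma poly_mapping_sum_single:
  "f = (\<Sum>m\<in>Poly_Mapping.keys f. Poly_Mapping.single m (Poly_Mapping.lookup f m))"
  by (rule poly_mapping_eqI)
    (auto simp: lookup_sum lookup_single when_def in_keys_iff sum.delta)

text \<open>Both sides are biadditive, so the claim reduces to single monomials, whose exponents add
  under multiplication.\<close>

lemma mpoly_eval_mult [simp]: "mpoly_eval x (f * g) = mpoly_eval x f * mpoly_eval x g"
proof -
  have single: "mpoly_eval x (Poly_Mapping.single m a * Poly_Mapping.single n b) =
      mpoly_eval x (Poly_Mapping.single m a) * mpoly_eval x (Poly_Mapping.single n b)" for m n a b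
    by (simp add: mult_single lookup_add power_add prod.distrib)
  have "mpoly_eval x (f * g) =
      (\<Sum>m\<in>Poly_Mapping.keys f. \<Sum>n\<in>Poly_Mapping.keys g.
        mpoly_eval x (Poly_Mapping.single m (Poly_Mapping.lookup f m)) *
        mpoly_eval x (Poly_Mapping.single n (Poly_Mapping.lookup g n)))"
    by (subst poly_mapping_sum_single[of f], subst poly_mapping_sum_single[of g])
      (simp only: sum_product mpoly_eval_sum single)
  also have "\<dots> = mpoly_eval x f * mpoly_eval x g"
    by (simp only: sum_product[symmetric] mpoly_eval_sum[symmetric] poly_mapping_sum_single[symmetric])
  finally show ?thesis .
qed

lemma mpoly_eval_1 [simp]: "mpoly_eval x 1 = 1"
  using mpoly_eval_single[of x 0 1] by simp

lemma mpoly_eval_prod [simp]: "mpoly_eval x (\<Prod>i\<in>A. f i) = (\<Prod>i\<in>A. mpoly_eval x (f i))"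
  by (induction A rule: infinite_finite_induct) auto

lemma mpoly_eval_power [simp]: "mpoly_eval x (f ^ n) = mpoly_eval x f ^ n"
  by (induction n) auto

lemma homogeneous_0 [simp]: "homogeneous d 0"
  by (simp add: homogeneous_def)

lemma homogeneous_1: "homogeneous 0 1"
  by (simp add: homogeneous_def)

lemma homogeneous_add: "homogeneous d f \<Longrightarrow> homogeneous d g \<Longrightarrow> homogeneous d (f + g)"
  using keys_add[of f g] by (auto simp: homogeneous_def)

lemma homogeneous_uminus: "homogeneous d f \<Longrightarrow> homogeneous d (- f)"
  by (simp add: homogeneous_def)

lemma homogeneous_diff:
  fixes f g :: "('n::finite, 'k::ab_group_add) mpoly"
  shows "homogeneous d f \<Longrightarrow> homogeneous d g \<Longrightarrow> homogeneous d (f - g)"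
  using homogeneous_add[of d f "- g"] homogeneous_uminus[of d g] by simp

lemma homogeneous_mult:
  fixes f g :: "('n::finite, 'k::comm_ring_1) mpoly"
  shows "homogeneous d f \<Longrightarrow> homogeneous e g \<Longrightarrow> homogeneous (d + e) (f * g)"
  using keys_mult[of f g] by (fastforce simp: homogeneous_def lookup_add sum.distrib)

lemma homogeneous_single:
  "(\<Sum>i\<in>UNIV. Poly_Mapping.lookup m i) = d \<Longrightarrow> homogeneous d (Poly_Mapping.single m c)"
  by (auto simp: homogeneous_def)

lemma homogeneous_const_mult:
  fixes f :: "('n::finite, 'k::comm_ring_1) mpoly"
  shows "homogeneous d f \<Longrightarrow> homogeneous d (Poly_Mapping.single 0 c * f)"
  using homogeneous_mult[OF homogeneous_single[of 0 0 c], of d f] by simp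

lemma homogeneous_prod:
  fixes f :: "'a \<Rightarrow> ('n::finite, 'k::comm_ring_1) mpoly"
  assumes "\<And>i. i \<in> A \<Longrightarrow> homogeneous (d i) (f i)"
  shows "homogeneous (\<Sum>i\<in>A. d i) (\<Prod>i\<in>A. f i)"
  using assms
proof (induction A rule: infinite_finite_induct)
  case (insert a A)
  then show ?case by (simp add: homogeneous_mult)
qed (simp_all add: homogeneous_1)

lemma homogeneous_sum:
  "(\<And>i. i \<in> A \<Longrightarrow> homogeneous d (f i)) \<Longrightarrow> homogeneous d (\<Sum>i\<in>A. f i)"
  by (induction A rule: infinite_finite_induct) (auto intro: homogeneous_add)

text \<open>Each monomial of \<open>f\<close> picks up the factor \<open>c ^ d\<close>. Hence
  whether a form vanishes at a projective point does not depend on the representative.\<close>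

lemma mpoly_eval_homogeneous:
  assumes "homogeneous d f"
  shows "mpoly_eval (\<lambda>i. c * x i) f = c ^ d * mpoly_eval x f"
  unfolding mpoly_eval_def sum_distrib_left
proof (rule sum.cong)
  fix m assume "m \<in> Poly_Mapping.keys f"
  then have "(\<Prod>i\<in>UNIV. c ^ Poly_Mapping.lookup m i) = c ^ d"
    using assms by (simp add: homogeneous_def power_sum[symmetric])
  then show "Poly_Mapping.lookup f m * (\<Prod>i\<in>UNIV. (c * x i) ^ Poly_Mapping.lookup m i) =
      c ^ d * (Poly_Mapping.lookup f m * (\<Prod>i\<in>UNIV. x i ^ Poly_Mapping.lookup m i))"
    by (simp add: power_mult_distrib prod.distrib)
qed simp

definition mpoly_var :: "'n \<Rightarrow> ('n::finite, 'k::comm_ring_1) mpoly" where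
  "mpoly_var i = Poly_Mapping.single (Poly_Mapping.single i 1) 1"

lemma mpoly_eval_var [simp]: "mpoly_eval x (mpoly_var i) = x i"
proof -
  have "(\<Prod>j\<in>UNIV. x j ^ Poly_Mapping.lookup (Poly_Mapping.single i 1) j) = (\<Prod>j\<in>UNIV. if j = i then x i else 1)"
    by (rule prod.cong) (auto simp: lookup_single when_def)
  then show ?thesis by (simp add: mpoly_var_def)
qed

lemma homogeneous_var: "homogeneous 1 (mpoly_var i)"
  by (auto simp: mpoly_var_def lookup_single when_def intro!: homogeneous_single)

lemma homogeneous_var_power: "homogeneous e (mpoly_var i ^ e)"
  using homogeneous_prod[of "{..<e}" "\<lambda>_. 1" "\<lambda>_. mpoly_var i", OF homogeneous_var] by simp

section \<open>Projective points and interpolation by forms\<close>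

lemma equiv_proj_rel:
  "equiv (UNIV - {\<lambda>_. 0}) (proj_rel :: (('n \<Rightarrow> 'k::field) \<times> ('n \<Rightarrow> 'k)) set)"
  (is "equiv _ ?R")
proof (rule equivI)
  show "refl_on (UNIV - {\<lambda>_. 0}) ?R"
    by (auto simp: refl_on_def proj_rel_def intro!: exI[of _ 1])
  show "?R \<subseteq> (UNIV - {\<lambda>_. 0}) \<times> (UNIV - {\<lambda>_. 0})" by (auto simp: proj_rel_def)
  show "sym ?R"
  proof (rule symI)
    fix x y :: "'n \<Rightarrow> 'k" assume "(x, y) \<in> ?R"
    then obtain c where "x \<noteq> (\<lambda>_. 0)" "y \<noteq> (\<lambda>_. 0)" "c \<noteq> 0" "y = (\<lambda>i. c * x i)"
      by (auto simp: proj_rel_def)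
    then show "(y, x) \<in> ?R"
      by (auto simp: proj_rel_def intro!: exI[of _ "inverse c"])
  qed
  show "trans ?R"
  proof (rule transI)
    fix x y z :: "'n \<Rightarrow> 'k" assume "(x, y) \<in> ?R" "(y, z) \<in> ?R"
    then obtain c e where "x \<noteq> (\<lambda>_. 0)" "z \<noteq> (\<lambda>_. 0)" "c \<noteq> 0" "y = (\<lambda>i. c * x i)" "e \<noteq> 0" "z = (\<lambda>i. e * y i)"
      by (auto simp: proj_rel_def)
    then show "(x, z) \<in> ?R"
      by (auto simp: proj_rel_def mult.assoc intro!: exI[of _ "e * c"])
  qed
qed

text \<open>Non-proportional vectors have a nonzero 2x2 minor \<open>y b * x a - y a * x b\<close>.
  Replacing \<open>x\<close> by the variables in this minor gives a form that vanishes at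
  \<open>y\<close> and takes the minor as its value at \<open>x\<close>.\<close>

lemma separating_linear_form:
  fixes x y :: "'n::finite \<Rightarrow> 'k::field"
  assumes "x \<noteq> (\<lambda>_. 0)" "y \<noteq> (\<lambda>_. 0)" "(x, y) \<notin> proj_rel"
  obtains l where "homogeneous 1 l" "mpoly_eval x l \<noteq> 0" "mpoly_eval y l = 0"
proof -
  have "\<exists>a b. y b * x a \<noteq> y a * x b"
  proof (rule ccontr)
    assume *: "\<not> ?thesis"
    obtain a where a: "x a \<noteq> 0" using assms(1) by auto
    \<comment> \<open>If all minors vanish, the ratio at one coordinate with
      \<open>x a \<noteq> 0\<close> is the ratio at every coordinate.\<close>
    define c where "c = y a / x a"
    have y: "y = (\<lambda>b. c * x b)" using * a by (auto simp: c_def field_simps)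
    then have "c \<noteq> 0" using assms(2) by auto
    then show False using assms y by (auto simp: proj_rel_def)
  qed
  then obtain a b where ab: "y b * x a \<noteq> y a * x b" by blast
  let ?l = "Poly_Mapping.single 0 (y b) * mpoly_var a - Poly_Mapping.single 0 (y a) * mpoly_var b"
  show thesis
  proof
    show "homogeneous 1 ?l" by (intro homogeneous_diff homogeneous_const_mult homogeneous_var)
    show "mpoly_eval x ?l \<noteq> 0" "mpoly_eval y ?l = 0" using ab by simp_all
  qed
qed

text \<open>Lagrange interpolation by forms of one fixed degree: a form for each point that is 1
  there and 0 at the others, then a linear combination with the prescribed values.\<close>

lemma homogeneous_interpolation:
  fixes p :: "'a \<Rightarrow> 'n::finite \<Rightarrow> 'k::field"
  assumes "finite J" and nz: "\<And>j. j \<in> J \<Longrightarrow> p j \<noteq> (\<lambda>_. 0)"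
    and sep: "\<And>j k. j \<in> J \<Longrightarrow> k \<in> J \<Longrightarrow> (p j, p k) \<in> proj_rel \<Longrightarrow> j = k"
    and d: "card J \<le> d + 1"
  shows "\<exists>f. homogeneous d f \<and> (\<forall>j\<in>J. mpoly_eval (p j) f = w j)"
proof -
  have "\<exists>h. homogeneous d h \<and> (\<forall>j\<in>J. mpoly_eval (p j) h = (if j = k then 1 else 0))"
    if k: "k \<in> J" for k
  proof -
    have "\<forall>j\<in>J - {k}. \<exists>l. homogeneous 1 l \<and> mpoly_eval (p k) l \<noteq> 0 \<and> mpoly_eval (p j) l = 0"
      using separating_linear_form[of "p k"] nz sep k by (metis Diff_iff insertCI)
    then obtain l where l: "\<And>j. j \<in> J - {k} \<Longrightarrow>
        homogeneous 1 (l j) \<and> mpoly_eval (p k) (l j) \<noteq> 0 \<and> mpoly_eval (p j) (l j) = 0"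
      by metis
    obtain a where a: "p k a \<noteq> 0" using nz[OF k] by auto
    \<comment> \<open>The product has degree \<open>card J - 1\<close>; a power of a variable that
      is nonzero at \<open>p k\<close> raises it to exactly \<open>d\<close>. The bound on
      \<open>card J\<close> keeps the natural subtraction from truncating.\<close>
    define g where "g = (\<Prod>j\<in>J - {k}. l j) * mpoly_var a ^ (d - card (J - {k}))"
    have "homogeneous ((\<Sum>j\<in>J - {k}. 1) + (d - card (J - {k}))) g"
      unfolding g_def by (intro homogeneous_mult homogeneous_prod homogeneous_var_power) (use l in auto)
    moreover have "card (J - {k}) \<le> d" using d k by simp
    ultimately have g: "homogeneous d g" by simp
    have gk: "mpoly_eval (p k) g \<noteq> 0" using l a assms(1) by (simp add: g_def)
    have gj: "mpoly_eval (p j) g = 0" if "j \<in> J" "j \<noteq> k" for j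
      using l[of j] that assms(1) by (auto simp: g_def)
    show ?thesis
      by (rule exI[of _ "Poly_Mapping.single 0 (inverse (mpoly_eval (p k) g)) * g"])
        (use g gk gj in \<open>auto intro: homogeneous_const_mult\<close>)
  qed
  then obtain h where h: "\<And>k. k \<in> J \<Longrightarrow> homogeneous d (h k)"
      "\<And>j k. j \<in> J \<Longrightarrow> k \<in> J \<Longrightarrow> mpoly_eval (p j) (h k) = (if j = k then 1 else 0)"
    by metis
  let ?f = "\<Sum>k\<in>J. Poly_Mapping.single 0 (w k) * h k"
  have "mpoly_eval (p j) ?f = w j" if j: "j \<in> J" for j
  proof -
    have "mpoly_eval (p j) ?f = (\<Sum>k\<in>J. if j = k then w k else 0)"
      by (simp, rule sum.cong) (use j h in auto)
    then show ?thesis using j assms(1) by simp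
  qed
  moreover have "homogeneous d ?f" by (intro homogeneous_sum homogeneous_const_mult h)
  ultimately show ?thesis by blast
qed

section \<open>Vanishing ideals and their Hilbert functions\<close>

text \<open>All polynomials vanishing at every representative, homogeneous or not, form an ideal
  \<open>?I\<close> containing the generators. So the generated ideal lies in \<open>?I\<close>, and
  its homogeneous elements are generators themselves.\<close>

lemma vanishing_ideal_inter_graded_component:
  fixes X :: "('n::finite \<Rightarrow> 'k::field) set set"
  shows "vanishing_ideal X \<inter> {f. homogeneous d f} =
    {f. homogeneous d f \<and> (\<forall>P\<in>X. \<forall>y\<in>P. mpoly_eval y f = 0)}"
proof -
  let ?I = "{f :: ('n, 'k) mpoly. \<forall>P\<in>X. \<forall>y\<in>P. mpoly_eval y f = 0}"
  have "ideal ?I class_ring"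
  proof (rule idealI)
    show "ring (class_ring :: ('n, 'k) mpoly ring)" by (rule class_ring.ring_axioms)
    show "subgroup ?I (add_monoid class_ring)"
    proof (rule group.subgroupI)
      show "group (add_monoid (class_ring :: ('n, 'k) mpoly ring))"
        by (rule abelian_group.a_group[OF ring.is_abelian_group[OF class_ring.ring_axioms]])
      show "inv\<^bsub>add_monoid class_ring\<^esub> f \<in> ?I" if "f \<in> ?I" for f
        using that unfolding a_inv_def[symmetric] by (simp add: class_ring_simps)
    qed (auto intro: exI[of _ 0])
  qed auto
  then have "vanishing_ideal X \<subseteq> ?I"
    unfolding vanishing_ideal_def by (rule ring.genideal_minimal[OF class_ring.ring_axioms]) auto
  moreover have "{f. (\<exists>d. homogeneous d f) \<and> (\<forall>P\<in>X. \<forall>y\<in>P. mpoly_eval y f = 0)} \<subseteq> vanishing_ideal X"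
    unfolding vanishing_ideal_def by (rule ring.genideal_self[OF class_ring.ring_axioms]) simp
  ultimately show ?thesis by blast
qed

lemma vectorspace_graded_component:
  "vectorspace class_ring (graded_component d :: ('k::field, ('n::finite, 'k) mpoly) module)"
proof (rule vs_criteria)
  show "\<forall>v\<in>carrier (graded_component d). \<exists>neg_v\<in>carrier (graded_component d).
      v \<oplus>\<^bsub>graded_component d\<^esub> neg_v = \<zero>\<^bsub>graded_component d :: ('k, ('n, 'k) mpoly) module\<^esub>"
    by (auto simp: graded_component_def intro!: homogeneous_uminus intro: exI[of _ "- _"])
qed (auto simp: graded_component_def class_field homogeneous_add homogeneous_const_mult
    add_ac distrib_left distrib_right mult_single single_add simp flip: mult.assoc)

lemma hilbert_function_vanishing_ideal:
  fixes X :: "('n::finite \<Rightarrow> 'k::field) set set"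
  assumes fin: "finite X" and X: "X \<subseteq> proj_space" and d: "card X \<le> d + 1"
  shows "hilbert_function (vanishing_ideal X) d = card X"
proof -
  define N where "N = card X"
  define S where "S = (graded_component d :: ('k, ('n, 'k) mpoly) module)"
  \<comment> \<open>Numbering the points lets functions on \<open>X\<close> be coordinate vectors of
    length \<open>N\<close>, a space of known dimension.\<close>
  obtain e where e: "bij_betw e {..<N} X"
    using ex_bij_betw_nat_finite[OF fin] by (auto simp: N_def atLeast0LessThan)
  have "\<exists>y. y \<noteq> (\<lambda>_. 0) \<and> e k = proj_rel `` {y}" if "k < N" for k
  proof -
    have "e k \<in> proj_space" using that bij_betwE[OF e] X by auto
    then show ?thesis by (auto simp: proj_space_def quotient_def)
  qed
  then obtain p where p: "\<And>k. k < N \<Longrightarrow> p k \<noteq> (\<lambda>_. 0) \<and> e k = proj_rel `` {p k}"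
    by metis
  have X_eq: "X = (\<lambda>k. proj_rel `` {p k}) ` {..<N}"
    using e p by (auto simp: bij_betw_def)
  have dN: "card {..<N} \<le> d + 1" using d by (simp add: N_def)
  have nz: "p j \<noteq> (\<lambda>_. 0)" if "j \<in> {..<N}" for j using that p by simp
  have sep: "j = k" if "j \<in> {..<N}" "k \<in> {..<N}" "(p j, p k) \<in> proj_rel" for j k
    using that p equiv_class_eq[OF equiv_proj_rel that(3)] bij_betw_imp_inj_on[OF e]
    by (auto simp: inj_on_def)
  \<comment> \<open>One representative per point suffices: the value at any other differs by a
    factor \<open>c ^ d\<close>.\<close>
  have vanish: "(\<forall>P\<in>X. \<forall>y\<in>P. mpoly_eval y f = 0) \<longleftrightarrow> (\<forall>k<N. mpoly_eval (p k) f = 0)"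
    if "homogeneous d f" for f
  proof
    assume *: "\<forall>P\<in>X. \<forall>y\<in>P. mpoly_eval y f = 0"
    show "\<forall>k<N. mpoly_eval (p k) f = 0"
    proof safe
      fix k assume "k < N"
      then have "p k \<in> proj_rel `` {p k}" using p by (auto simp: proj_rel_def intro: exI[of _ 1])
      then show "mpoly_eval (p k) f = 0" using * \<open>k < N\<close> by (auto simp: X_eq)
    qed
  qed (use mpoly_eval_homogeneous[OF that] in \<open>auto simp: X_eq proj_rel_def\<close>)
  define T where "T f = vec N (\<lambda>k. mpoly_eval (p k) f)" for f
  have T: "linear_map class_ring S (module_vec TYPE('k) N) T"
  proof -
    interpret S: vectorspace class_ring S
      unfolding S_def by (rule vectorspace_graded_component)
    interpret V: vectorspace class_ring "module_vec TYPE('k) N" by (rule vec_vs)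
    show ?thesis
      by unfold_locales
        (auto simp: module_hom_def S_def graded_component_def T_def module_vec_simps)
  qed
  have surj: "T ` carrier S = carrier (module_vec TYPE('k) N)"
  proof
    show "T ` carrier S \<subseteq> carrier (module_vec TYPE('k) N)"
      by (auto simp: T_def module_vec_simps)
    show "carrier (module_vec TYPE('k) N) \<subseteq> T ` carrier S"
    proof
      fix w assume "w \<in> carrier (module_vec TYPE('k) N)"
      then have w: "dim_vec w = N" unfolding module_vec_simps by (rule carrier_vecD)
      have "\<exists>f. homogeneous d f \<and> (\<forall>j\<in>{..<N}. mpoly_eval (p j) f = w $ j)"
        by (rule homogeneous_interpolation[OF finite_lessThan nz sep dN])
      then obtain f where "homogeneous d f" "\<forall>j\<in>{..<N}. mpoly_eval (p j) f = w $ j"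
        by blast
      then have "T f = w" "f \<in> carrier S"
        using w by (auto simp: T_def S_def graded_component_def)
      then show "w \<in> T ` carrier S" by blast
    qed
  qed
  have "vanishing_ideal X \<inter> carrier S = {f \<in> carrier S. T f = \<zero>\<^bsub>module_vec TYPE('k) N\<^esub>}"
    using vanishing_ideal_inter_graded_component[of X d] vanish
    by (auto simp: S_def graded_component_def T_def module_vec_simps vec_eq_iff)
  then show ?thesis
    using quotient_module_kernel[OF T surj vec_space.fin_dim]
    by (simp add: hilbert_function_def S_def N_def vec_space.dim_is_n)
qed

text \<open>The Hilbert function is eventually constant, so the Hilbert polynomial is a constant, of
  degree 0, and the factorial is 1.\<close>

lemma quotient_degree_vanishing_ideal:
  fixes X :: "('n::finite \<Rightarrow> 'k::field) set set"
  assumes "finite X" "X \<subseteq> proj_space"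
  shows "quotient_degree (vanishing_ideal X) = of_nat (card X)"
proof -
  have H: "\<forall>\<^sub>F d in sequentially. hilbert_function (vanishing_ideal X) d = card X"
    using eventually_ge_at_top[of "card X"]
    by eventually_elim (simp add: hilbert_function_vanishing_ideal[OF assms])
  have "hilbert_polynomial (vanishing_ideal X) = [:of_nat (card X):]"
    unfolding hilbert_polynomial_def
  proof (rule the_equality)
    show "\<forall>\<^sub>F d in sequentially. poly [:of_nat (card X):] (of_nat d) =
        (of_nat (hilbert_function (vanishing_ideal X) d) :: rat)"
      using H by eventually_elim simp
  next
    fix h :: "rat poly"
    assume "\<forall>\<^sub>F d in sequentially. poly h (of_nat d) = of_nat (hilbert_function (vanishing_ideal X) d)"
    with H have "\<forall>\<^sub>F d in sequentially. poly (h - [:of_nat (card X):]) (of_nat d) = 0"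
      by eventually_elim simp
    then obtain m where m: "\<And>d. d \<ge> m \<Longrightarrow> poly (h - [:of_nat (card X):]) (of_nat d) = 0"
      by (auto simp: eventually_sequentially)
    \<comment> \<open>Uniqueness: the difference of two candidates has infinitely many rational
      roots, hence is zero.\<close>
    have "infinite (of_nat ` {m..} :: rat set)"
      by (simp add: finite_image_iff inj_on_def infinite_Ici)
    moreover have "of_nat ` {m..} \<subseteq> {x. poly (h - [:of_nat (card X):]) x = 0}" using m by auto
    ultimately have "infinite {x. poly (h - [:of_nat (card X):]) x = 0}"
      using finite_subset by blast
    then show "h = [:of_nat (card X):]" by (metis eq_iff_diff_eq_0 poly_roots_finite)
  qed
  then show ?thesis by (simp add: quotient_degree_def)
qed

section \<open>Roots of unity in a finite field\<close>

text \<open>The fibres of \<open>f\<close> partition \<open>A\<close>. This is used to pass from the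
  affine torus to its projective image.\<close>

lemma card_image_uniform_fibers:
  assumes "finite A" and "\<And>a. a \<in> A \<Longrightarrow> card {b \<in> A. f b = f a} = k"
  shows "card A = card (f ` A) * k"
proof -
  have "card A = (\<Sum>y\<in>f ` A. card {b \<in> A. f b = y})"
    using sum.image_gen[OF assms(1), of "\<lambda>_. 1 :: nat" f] by simp
  also have "\<dots> = (\<Sum>y\<in>f ` A. k)"
    by (rule sum.cong) (use assms(2) in auto)
  finally show ?thesis by simp
qed

lemma group_unit_group_of_field: "group (unit_group_of_field :: 'k::field monoid)"
  by (rule field.field_mult_group[OF class_field])

lemma pow_unit_group_of_field: "x [^]\<^bsub>unit_group_of_field\<^esub> (n::nat) = (x::'k::field) ^ n"
  by (simp add: nat_pow_mult_of class_ring_simps)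

lemma card_roots_of_unity_le:
  assumes "n > 0"
  shows "card {x::'k::finite_field. x ^ n = 1} \<le> n"
  using domain.num_roots_le_deg[OF field.axioms(1)[OF class_field[where 'a = 'k]], of n] assms
  by (simp add: class_ring_simps)

context
  fixes \<beta> :: "'k::finite_field"
  assumes unit: "\<beta> \<in> carrier unit_group_of_field"
    and gen: "generate unit_group_of_field {\<beta>} = carrier unit_group_of_field"
begin

interpretation G: group "unit_group_of_field :: 'k monoid"
  by (rule group_unit_group_of_field)

lemma nonzero_eq_power_generator:
  assumes "(x::'k) \<noteq> 0"
  obtains k :: nat where "x = \<beta> ^ k"
proof -
  have "x \<in> generate unit_group_of_field {\<beta>}" using assms by (simp add: gen class_ring_simps)
  then show thesis
    using G.generate_pow_on_finite_carrier[OF _ unit] that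
    by (auto simp: pow_unit_group_of_field)
qed

text \<open>A squeeze: the subgroup generated by \<open>\<beta> ^ n\<close>, with \<open>d\<close>
  elements, lies in the set of \<open>n\<close>-th powers, which lies in the set of
  \<open>d\<close>-th roots of unity, of size at most \<open>d\<close>. All three coincide.\<close>

lemma range_power_eq_roots_of_unity:
  fixes n :: nat
  defines "d \<equiv> group.ord unit_group_of_field (\<beta> ^ n)"
  shows "{x ^ n | x::'k. x \<noteq> 0} = {y. y ^ d = 1}"
    and "card {y::'k. y ^ d = 1} = d" and "d > 0"
proof -
  have b: "\<beta> ^ n \<in> carrier unit_group_of_field" using unit by (simp add: class_ring_simps)
  show d: "d > 0" unfolding d_def using G.ord_ge_1[OF _ b] by simp
  have sub: "{x ^ n | x::'k. x \<noteq> 0} \<subseteq> {y. y ^ d = 1}"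
  proof clarify
    fix x :: 'k assume "x \<noteq> 0"
    then obtain k :: nat where "x = \<beta> ^ k" by (rule nonzero_eq_power_generator)
    then have "(x ^ n) ^ d = ((\<beta> ^ n) ^ d) ^ k" by (simp flip: power_mult add: ac_simps)
    also have "(\<beta> ^ n) ^ d = 1"
      using G.pow_ord_eq_1[OF b] by (simp add: pow_unit_group_of_field d_def class_ring_simps)
    finally show "(x ^ n) ^ d = 1" by simp
  qed
  have "generate unit_group_of_field {\<beta> ^ n} \<subseteq> {x ^ n | x. x \<noteq> 0}"
  proof
    fix y assume "y \<in> generate unit_group_of_field {\<beta> ^ n}"
    then obtain k :: nat where "y = (\<beta> ^ n) ^ k"
      using G.generate_pow_on_finite_carrier[OF _ b] by (auto simp: pow_unit_group_of_field)
    then have "y = (\<beta> ^ k) ^ n" by (simp flip: power_mult add: ac_simps)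
    then show "y \<in> {x ^ n | x. x \<noteq> 0}" using unit by (auto simp: class_ring_simps)
  qed
  then have "d \<le> card {x ^ n | x::'k. x \<noteq> 0}"
    unfolding d_def G.generate_pow_card[OF b] by (intro card_mono) auto
  then show "{x ^ n | x::'k. x \<noteq> 0} = {y. y ^ d = 1}" and "card {y::'k. y ^ d = 1} = d"
    using card_mono[OF _ sub] card_roots_of_unity_le[OF d, where 'k='k] card_seteq[OF _ sub] by auto
qed

text \<open>If the order of \<open>\<beta>\<close> is \<open>m * n\<close>, then
  \<open>\<beta> ^ n\<close> has order \<open>m\<close>, and the count for orders of powers of
  \<open>\<beta>\<close> applies.\<close>

lemma card_roots_of_unity:
  assumes "m dvd group.ord unit_group_of_field \<beta>"
  shows "card {y::'k. y ^ m = 1} = m"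
proof -
  let ?N = "group.ord unit_group_of_field \<beta>"
  have N: "?N > 0" using G.ord_ge_1[OF _ unit] by simp
  obtain n where n: "?N = m * n" using assms by blast
  have "group.ord unit_group_of_field (\<beta> ^ n) = m"
    using G.ord_pow[OF unit, of n] n N by (auto simp: pow_unit_group_of_field)
  then show ?thesis using range_power_eq_roots_of_unity(2)[of n] by simp
qed

lemma ord_power_generator_dvd:
  "group.ord unit_group_of_field (\<beta> ^ n) dvd group.ord unit_group_of_field \<beta>"
proof -
  have "(\<beta> ^ n) ^ G.ord \<beta> = (\<beta> ^ G.ord \<beta>) ^ n" by (simp flip: power_mult add: ac_simps)
  also have "\<beta> ^ G.ord \<beta> = 1" using G.pow_ord_eq_1[OF unit] by (simp add: pow_unit_group_of_field)
  finally show ?thesis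
    using G.pow_eq_id[of "\<beta> ^ n" "G.ord \<beta>"] unit by (simp add: pow_unit_group_of_field)
qed

end

text \<open>A power \<open>c ^ n\<close> is 1 iff the order of \<open>c\<close> divides
  \<open>n\<close>, and a number divides a gcd iff it divides every member.\<close>

lemma power_Gcd_eq_1_iff:
  fixes c :: "'k::field" and d :: "'n::finite \<Rightarrow> nat"
  assumes "c \<noteq> 0"
  shows "c ^ Gcd (range d) = 1 \<longleftrightarrow> (\<forall>i. c ^ d i = 1)"
proof -
  interpret G: group "unit_group_of_field :: 'k monoid"
    by (rule group_unit_group_of_field)
  have "c ^ n = 1 \<longleftrightarrow> group.ord unit_group_of_field c dvd n" for n
    using G.pow_eq_id[of c n] assms by (simp add: pow_unit_group_of_field class_ring_simps)
  then show ?thesis by (auto simp: dvd_Gcd_iff)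
qed

section \<open>Counting the affine and projective torus\<close>

theorem lemma3p11:
  fixes v d :: "'n::finite \<Rightarrow> nat"
    and \<beta> :: "'k::finite_field"
  assumes "\<And>i. v i > 0"
    and "\<beta> \<in> carrier unit_group_of_field"
    and "generate unit_group_of_field {\<beta>} = carrier unit_group_of_field"
    and "\<And>i. d i = group.ord unit_group_of_field (\<beta> ^ v i)"
  shows "card (affine_torus v :: ('n \<Rightarrow> 'k) set) = (\<Prod>i\<in>UNIV. d i) \<and>
    quotient_degree (vanishing_ideal (proj_torus v :: ('n \<Rightarrow> 'k) set set)) =
      of_nat (card (proj_torus v :: ('n \<Rightarrow> 'k) set set)) \<and>
    (of_nat (card (proj_torus v :: ('n \<Rightarrow> 'k) set set)) :: rat) =
      of_nat (\<Prod>i\<in>UNIV. d i) / of_nat (Gcd (range d))"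
proof (intro conjI)
  define g where "g = Gcd (range d)"
  let ?A = "affine_torus v :: ('n \<Rightarrow> 'k) set"
  let ?X = "proj_torus v :: ('n \<Rightarrow> 'k) set set"
  let ?cls = "\<lambda>x :: 'n \<Rightarrow> 'k. proj_rel `` {x}"
  note roots = range_power_eq_roots_of_unity[OF assms(2,3), of "v _", folded assms(4)]
  \<comment> \<open>The coordinates vary independently, so the torus is a product set; a preimage
    \<open>x\<close> is chosen coordinate by coordinate.\<close>
  have A_Pi: "?A = PiE UNIV (\<lambda>i. {x ^ v i | x. x \<noteq> 0})"
    unfolding affine_torus_def PiE_UNIV_domain by (auto simp: fun_eq_iff Pi_def) metis
  then have A_roots: "?A = {x. \<forall>i. x i ^ d i = 1}"
    unfolding roots(1) by (auto simp: PiE_UNIV_domain)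
  have A_nz: "x i \<noteq> 0" if "x \<in> ?A" for x i
    using that roots(3)[of i] by (auto simp: affine_torus_def)
  show card_A: "card ?A = (\<Prod>i\<in>UNIV. d i)"
    unfolding A_Pi roots(1) by (simp add: card_PiE roots(2))
  have X_image: "?X = ?cls ` ?A"
    by (auto simp: affine_torus_def proj_torus_def image_def)
  show "quotient_degree (vanishing_ideal ?X) = of_nat (card ?X)"
    by (rule quotient_degree_vanishing_ideal[OF _ proj_torus_subset]) (simp add: X_image)
  have g_dvd: "g dvd d i" for i by (simp add: g_def)
  \<comment> \<open>Here \<open>undefined\<close> is just some index: the type \<open>'n\<close> is
    nonempty, so \<open>g\<close> divides at least one positive \<open>d i\<close>.\<close>
  have g0: "g \<noteq> 0" using g_dvd[of undefined] roots(3)[of undefined] by auto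
  have "card {b \<in> ?A. ?cls b = ?cls a} = g" if a: "a \<in> ?A" for a
  proof -
    have a0: "a \<noteq> (\<lambda>_. 0)" and b0: "b \<in> ?A \<Longrightarrow> b \<noteq> (\<lambda>_. 0)" for b
      using A_nz a by (auto simp: fun_eq_iff)
    have "{b \<in> ?A. ?cls b = ?cls a} = {b \<in> ?A. (a, b) \<in> proj_rel}"
      using a0 b0 by (auto simp: eq_equiv_class_iff[OF equiv_proj_rel] equiv_proj_rel[THEN equiv_class_eq_iff])
    also have "\<dots> = {b \<in> ?A. \<exists>c. c \<noteq> 0 \<and> b = (\<lambda>i. c * a i)}"
      using a0 b0 by (auto simp: proj_rel_def)
    \<comment> \<open>Since \<open>a i ^ d i = 1\<close>, the multiple by \<open>c\<close> stays in
      the torus exactly when \<open>c ^ d i = 1\<close> for all \<open>i\<close>.\<close>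
    also have "\<dots> = (\<lambda>c i. c * a i) ` {c. c \<noteq> 0 \<and> (\<forall>i. c ^ d i = 1)}"
      using a by (auto simp: A_roots power_mult_distrib)
    also have "{c::'k. c \<noteq> 0 \<and> (\<forall>i. c ^ d i = 1)} = {c. c ^ g = 1}"
    proof -
      have "c \<noteq> 0" if "c ^ g = 1" for c :: 'k using that g0 by (auto simp: power_0_left)
      then show ?thesis using power_Gcd_eq_1_iff[of _ d] by (auto simp: g_def)
    qed
    \<comment> \<open>The coordinates of \<open>a\<close> are nonzero, so distinct scalars give
      distinct multiples.\<close>
    also have "card ((\<lambda>c i. c * a i) ` {c. c ^ g = 1}) = card {c::'k. c ^ g = 1}"
      using A_nz[OF a] by (intro card_image) (auto simp: inj_on_def fun_eq_iff)
    \<comment> \<open>Through any \<open>d i\<close>, \<open>g\<close> divides the order of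
      \<open>\<beta>\<close>, so there are exactly \<open>g\<close> of the \<open>g\<close>-th roots
      of unity.\<close>
    also have "g dvd group.ord unit_group_of_field \<beta>"
      using g_dvd[of undefined] ord_power_generator_dvd[OF assms(2,3), of "v undefined"]
      unfolding assms(4)[symmetric] by (rule dvd_trans)
    then have "card {c::'k. c ^ g = 1} = g" by (rule card_roots_of_unity[OF assms(2,3)])
    finally show ?thesis .
  qed
  then have "card ?A = card ?X * g"
    unfolding X_image by (intro card_image_uniform_fibers) simp_all
  then show "(of_nat (card ?X) :: rat) = of_nat (\<Prod>i\<in>UNIV. d i) / of_nat (Gcd (range d))"
    unfolding card_A[symmetric] g_def[symmetric] using g0 by simp
qed

end
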